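(* For all positive integers $n,m$, the second player wins the Peaceable Rooks Game $\mathrm{PR}(n,m)$ if and only if both $n$ and $m$ are even.
   Context: The Peaceable Rooks Game $\mathrm{PR}(n,m)$ is played on an $n\times m$ chessboard with squares $(x,y)$, $0\leq x\leq n-1$, $0\leq y\leq m-1$. Two players alternately place a rook on an unoccupied square; the first player places white rooks and the second player places black rooks. A player may not place a rook on a square within attacking range of a rook previously placed by the opponent. A player unable to move on their turn loses. Two distinct squares $(x_1,y_1)$ and $(x_2,y_2)$ are within attacking range for rooks iff $x_1=x_2$ or $y_1=y_2$ (regardless of any pieces standing between them). A player "wins" the game if that player has a winning strategy. *)

theory Defs
  imports Main
begin

type_synonym square = "nat \<times> nat"

definition board :: "nat \<Rightarrow> nat \<Rightarrow> square set" where
  "board n m = {0..<n} \<times> {0..<m}"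

definition attacks :: "square \<Rightarrow> square \<Rightarrow> bool" where
  "attacks s t \<longleftrightarrow> s \<noteq> t \<and> (fst s = fst t \<or> snd s = snd t)"

datatype player = First | Second

fun opponent :: "player \<Rightarrow> player" where
  "opponent First = Second"
| "opponent Second = First"

text \<open>A history is the list of the squares chosen so far, in chronological order, so the rooks
  at even indices are white and those at odd indices are black.\<close>

type_synonym history = "square list"

definition mover :: "history \<Rightarrow> player" where
  "mover h = (if even (length h) then First else Second)"

definition rooks :: "player \<Rightarrow> history \<Rightarrow> square set" where
  "rooks p h = {h ! i | i. i < length h \<and> mover (take i h) = p}"

definition legal :: "nat \<Rightarrow> nat \<Rightarrow> history \<Rightarrow> square \<Rightarrow> bool" where
  "legal n m h s \<longleftrightarrow> s \<in> board n m \<and> s \<notin> set h \<and>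
     (\<forall>t \<in> rooks (opponent (mover h)) h. \<not> attacks t s)"

inductive play :: "nat \<Rightarrow> nat \<Rightarrow> history \<Rightarrow> bool" for n m where
  start: "play n m []"
| move: "play n m h \<Longrightarrow> legal n m h s \<Longrightarrow> play n m (h @ [s])"

definition finished :: "nat \<Rightarrow> nat \<Rightarrow> history \<Rightarrow> bool" where
  "finished n m h \<longleftrightarrow> play n m h \<and> (\<nexists>s. legal n m h s)"

type_synonym strategy = "history \<Rightarrow> square"

definition follows :: "player \<Rightarrow> strategy \<Rightarrow> history \<Rightarrow> bool" where
  "follows p \<sigma> h \<longleftrightarrow> (\<forall>i < length h. mover (take i h) = p \<longrightarrow> h ! i = \<sigma> (take i h))"

text \<open>The first conjunct requires the strategy to choose a legal move whenever one exists; without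
  it, a play in which the strategy prescribes an illegal move would never be \<open>finished\<close> and the
  second conjunct could hold vacuously. No infinite plays need to be considered, since every move
  occupies a new square of a finite board.\<close>

definition winning_strategy :: "nat \<Rightarrow> nat \<Rightarrow> player \<Rightarrow> strategy \<Rightarrow> bool" where
  "winning_strategy n m p \<sigma> \<longleftrightarrow>
     (\<forall>h. play n m h \<and> follows p \<sigma> h \<and> mover h = p \<and> (\<exists>s. legal n m h s)
        \<longrightarrow> legal n m h (\<sigma> h)) \<and>
     (\<forall>h. finished n m h \<and> follows p \<sigma> h \<longrightarrow> mover h = opponent p)"

definition wins :: "player \<Rightarrow> nat \<Rightarrow> nat \<Rightarrow> bool" where
  "wins p n m \<longleftrightarrow> (\<exists>\<sigma>. winning_strategy n m p \<sigma>)"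

end

theory Submission
  imports Defs
begin

text \<open>Both directions use the reflection of the board in its centre. If both sides are even, no row
  or column is mapped to itself, so the second player can answer every move by its mirror image.
  Otherwise the first player opens on the square \<open>(n div 2, m div 2)\<close>, which closes every
  self-symmetric row and column to the second player, and mirrors from then on.\<close>

definition centre :: "nat \<Rightarrow> nat \<Rightarrow> square" where
  "centre n m = (n div 2, m div 2)"

definition mirror :: "nat \<Rightarrow> nat \<Rightarrow> square \<Rightarrow> square" where
  "mirror n m s = (n - 1 - fst s, m - 1 - snd s)"

text \<open>One formula serves both players: an empty history is met only by \<open>First\<close>,
  and otherwise \<open>last h\<close> is the opponent's latest rook.\<close>

definition mirror_strategy :: "nat \<Rightarrow> nat \<Rightarrow> strategy" where
  "mirror_strategy n m h = (if h = [] then centre n m else mirror n m (last h))"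

lemma opponent_opponent [simp]: "opponent (opponent p) = p"
  by (cases p) auto

lemma opponent_neq [simp]: "opponent p \<noteq> p" "p \<noteq> opponent p"
  by (cases p; simp)+

lemma neq_opponent_iff: "p \<noteq> q \<longleftrightarrow> p = opponent q"
  by (cases p; cases q) auto

lemma mover_Nil [simp]: "mover [] = First"
  by (simp add: mover_def)

lemma mover_snoc [simp]: "mover (h @ [s]) = opponent (mover h)"
  by (simp add: mover_def)

lemma rooks_Nil [simp]: "rooks p [] = {}"
  by (simp add: rooks_def)

lemma rooks_snoc [simp]:
  "rooks p (h @ [s]) = rooks p h \<union> (if mover h = p then {s} else {})"
proof (rule set_eqI)
  fix x
  let ?P = "\<lambda>g i. x = g ! i \<and> mover (take i g) = p"
  have "x \<in> rooks p (h @ [s]) \<longleftrightarrow> (\<exists>i < Suc (length h). ?P (h @ [s]) i)"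
    by (auto simp: rooks_def)
  also have "\<dots> \<longleftrightarrow> (\<exists>i < length h. ?P (h @ [s]) i) \<or> ?P (h @ [s]) (length h)"
    using less_Suc_eq by blast
  also have "(\<exists>i < length h. ?P (h @ [s]) i) \<longleftrightarrow> (\<exists>i < length h. ?P h i)"
    by (simp add: nth_append cong: conj_cong)
  also have "\<dots> \<longleftrightarrow> x \<in> rooks p h"
    by (auto simp: rooks_def)
  finally show "x \<in> rooks p (h @ [s]) \<longleftrightarrow>
      x \<in> rooks p h \<union> (if mover h = p then {s} else {})"
    by simp
qed

lemma set_eq_rooks: "set h = rooks p h \<union> rooks (opponent p) h"
  by (induction h rule: rev_induct) (auto simp: neq_opponent_iff)

lemma follows_Nil [simp]: "follows p \<sigma> []"
  by (simp add: follows_def)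

lemma follows_snoc [simp]:
  "follows p \<sigma> (h @ [s]) \<longleftrightarrow> follows p \<sigma> h \<and> (mover h = p \<longrightarrow> s = \<sigma> h)"
  by (auto simp: follows_def nth_append less_Suc_eq)

lemma attacks_commute: "attacks s t \<longleftrightarrow> attacks t s"
  by (auto simp: attacks_def)

lemma mirror_in_board [simp]: "s \<in> board n m \<Longrightarrow> mirror n m s \<in> board n m"
  by (auto simp: board_def mirror_def)

lemma mirror_mirror [simp]: "s \<in> board n m \<Longrightarrow> mirror n m (mirror n m s) = s"
  by (auto simp: board_def mirror_def)

lemma attacks_mirror_iff:
  assumes "s \<in> board n m" "t \<in> board n m"
  shows "attacks (mirror n m s) (mirror n m t) \<longleftrightarrow> attacks s t"
  using assms by (cases s; cases t) (auto simp: board_def mirror_def attacks_def)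

lemma reflect_fixed:
  fixes x n :: nat
  assumes "x = n - 1 - x" "x < n"
  shows "odd n \<and> x = n div 2"
proof -
  have "n = 2 * x + 1" using assms by linarith
  then show ?thesis by simp
qed

lemma reflect_middle:
  fixes x n :: nat
  assumes "n - 1 - x = n div 2" "x < n" "odd n"
  shows "x = n div 2"
proof -
  obtain k where "n = 2 * k + 1" using assms(3) by (rule oddE)
  then show ?thesis using assms(1,2) by simp
qed

text \<open>A square shares a line with its own image only on a row or column fixed by the
  reflection. Such a line needs an odd side and passes through \<open>centre n m\<close>.\<close>

lemma attacks_self_mirror:
  assumes "s \<in> board n m" "s = mirror n m s \<or> attacks s (mirror n m s)"
  shows "(odd n \<or> odd m) \<and> (s = centre n m \<or> attacks (centre n m) s)"
proof -
  obtain x y where s: "s = (x, y)" by (cases s)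
  have "x = n - 1 - x \<or> y = m - 1 - y"
    using assms(2) by (auto simp: s mirror_def attacks_def)
  moreover have "x < n" "y < m" using assms(1) by (auto simp: s board_def)
  ultimately have "(odd n \<and> x = n div 2) \<or> (odd m \<and> y = m div 2)"
    using reflect_fixed by blast
  then show ?thesis by (auto simp: s centre_def attacks_def)
qed

text \<open>Needed because the reflection moves the centre when just one side is odd. The square
  whose image is the centre then still lies on the middle line of the odd side.\<close>

lemma mirror_eq_centre:
  assumes "s \<in> board n m" "odd n \<or> odd m" "mirror n m s = centre n m"
  shows "s = centre n m \<or> attacks (centre n m) s"
proof -
  obtain x y where s: "s = (x, y)" by (cases s)
  have "n - 1 - x = n div 2" "m - 1 - y = m div 2"
    using assms(3) by (auto simp: s mirror_def centre_def)
  moreover have "x < n" "y < m" using assms(1) by (auto simp: s board_def)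
  ultimately have "x = n div 2 \<or> y = m div 2" using assms(2) reflect_middle by blast
  then show ?thesis by (auto simp: s centre_def attacks_def)
qed

lemma play_subset_board: "play n m h \<Longrightarrow> set h \<subseteq> board n m"
  by (induction rule: play.induct) (auto simp: legal_def)

lemma play_distinct: "play n m h \<Longrightarrow> distinct h"
  by (induction rule: play.induct) (auto simp: legal_def)

lemma play_length_le:
  assumes "play n m h"
  shows "length h \<le> n * m"
proof -
  have "card (set h) \<le> card (board n m)"
    by (intro card_mono play_subset_board assms) (simp add: board_def)
  then show ?thesis
    using play_distinct[OF assms] by (simp add: distinct_card board_def)
qed

text \<open>Any obstacle to the reply reflects to one that already forbade \<open>s\<close>. The
  exceptions are a conflict between \<open>s\<close> and its own image and the unpaired opening
  rook; both would put \<open>s\<close> on or in line with an occupied centre.\<close>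

lemma mirror_legal:
  assumes "play n m h" and legal: "legal n m h s" and p: "p = opponent (mover h)"
    and odd: "odd n \<or> odd m \<longleftrightarrow> p = First"
    and rooks: "rooks p h =
      (if p = First then {centre n m} else {}) \<union> mirror n m ` rooks (opponent p) h"
  shows "legal n m (h @ [s]) (mirror n m s)"
proof -
  have q: "mover h = opponent p" using p by simp
  let ?A = "rooks p h" and ?B = "rooks (opponent p) h" and ?s = "mirror n m s"
  have set: "set h = ?A \<union> ?B" by (rule set_eq_rooks)
  have safe: "\<not> attacks t s" if "t \<in> ?A" for t
    using legal that by (auto simp: legal_def set q)
  have s: "s \<in> board n m" "s \<notin> ?A" "s \<notin> ?B"
    using legal by (auto simp: legal_def set q)
  have board: "t \<in> board n m" if "t \<in> ?B" for t
    using that play_subset_board[OF assms(1)] set by auto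
  have B: "mirror n m t \<in> ?A" if "t \<in> ?B" for t
    using that rooks by auto
  \<comment> \<open>On a board with an odd side \<open>p\<close> is \<open>First\<close>, so the
    centre carries a rook hostile to the player of \<open>s\<close>.\<close>
  have no_centre: "\<not> (s = centre n m \<or> attacks (centre n m) s)" if "odd n \<or> odd m"
    using that odd rooks s safe by auto
  have self: "s \<noteq> ?s" "\<not> attacks s ?s"
    using attacks_self_mirror[OF s(1)] no_centre by blast+
  have "?s \<notin> ?A"
  proof
    assume "?s \<in> ?A"
    then consider "p = First" "?s = centre n m" | t where "t \<in> ?B" "?s = mirror n m t"
      using rooks by (auto split: if_splits)
    then show False
    proof cases
      case 1
      then show False using mirror_eq_centre[OF s(1)] odd no_centre by blast
    next
      case (2 t)
      then show False using mirror_mirror[OF s(1)] mirror_mirror[OF board] s by metis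
    qed
  qed
  \<comment> \<open>Were the image already an opposing rook, its answer would be \<open>s\<close>
    itself, which is vacant.\<close>
  moreover have "?s \<notin> ?B" using B[of ?s] s by auto
  \<comment> \<open>Reflecting such an attack gives one on \<open>s\<close> by the answer to
    \<open>t\<close>.\<close>
  moreover have "\<not> attacks t ?s" if "t \<in> ?B" for t
    using attacks_mirror_iff[of "mirror n m t" n m s] safe[OF B[OF that]] board[OF that] s
    by (simp add: attacks_commute)
  ultimately show ?thesis using self s by (auto simp: legal_def set q)
qed

text \<open>On the turn of \<open>p\<close> the latest opposing rook is still unanswered, so the
  symmetry holds only after inserting the reply. \<open>E\<close> is the opening rook, which answers
  nothing.\<close>

lemma mirror_strategy_invariant:
  assumes "n > 0" "m > 0" and odd: "odd n \<or> odd m \<longleftrightarrow> p = First"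
    and "play n m h" "follows p (mirror_strategy n m) h"
  defines "E \<equiv> if p = First then {centre n m} else {}"
  shows "if mover h = p
    then legal n m h (mirror_strategy n m h) \<and>
      insert (mirror_strategy n m h) (rooks p h) = E \<union> mirror n m ` rooks (opponent p) h
    else rooks p h = E \<union> mirror n m ` rooks (opponent p) h"
  using assms(4,5)
proof (induction rule: play.induct)
  case start
  then show ?case
    using assms(1,2) by (auto simp: E_def mirror_strategy_def legal_def board_def centre_def)
next
  case (move h s)
  show ?case
  proof (cases "mover h = p")
    case True
    \<comment> \<open>\<open>follows\<close> forces \<open>s\<close> to be the reply, so the
      inserted set in the induction hypothesis becomes the actual set of rooks.\<close>
    then show ?thesis using move by simp
  next
    case False
    then have q: "mover h = opponent p" by (simp add: neq_opponent_iff)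
    have rooks: "rooks p h = E \<union> mirror n m ` rooks (opponent p) h"
      using move False by simp
    have "legal n m (h @ [s]) (mirror n m s)"
      using mirror_legal[OF move(1,2) _ odd] rooks q by (simp add: E_def)
    then show ?thesis using rooks q by (simp add: mirror_strategy_def)
  qed
qed

lemma mirror_strategy_wins:
  assumes "n > 0" "m > 0" "odd n \<or> odd m \<longleftrightarrow> p = First"
  shows "wins p n m"
proof -
  have "legal n m h (mirror_strategy n m h)"
    if "play n m h" "follows p (mirror_strategy n m) h" "mover h = p" for h
    using mirror_strategy_invariant[OF assms that(1,2)] that(3) by simp
  then have "winning_strategy n m p (mirror_strategy n m)"
    unfolding winning_strategy_def finished_def by (metis neq_opponent_iff)
  then show ?thesis unfolding wins_def by blast
qed

text \<open>Two winning strategies played against each other would never stop, but the board is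
  finite. This replaces any appeal to determinacy in the main equivalence.\<close>

lemma not_both_win: "\<not> (wins First n m \<and> wins Second n m)"
proof
  assume "wins First n m \<and> wins Second n m"
  then obtain \<sigma> \<tau> where \<sigma>: "winning_strategy n m First \<sigma>" and \<tau>: "winning_strategy n m Second \<tau>"
    unfolding wins_def by blast
  have "\<exists>h. length h = k \<and> play n m h \<and> follows First \<sigma> h \<and> follows Second \<tau> h" for k
  proof (induction k)
    case 0
    then show ?case by (auto intro: play.start)
  next
    case (Suc k)
    then obtain h where h: "length h = k" "play n m h" "follows First \<sigma> h" "follows Second \<tau> h"
      by blast
    \<comment> \<open>At a finished position \<open>\<sigma>\<close> would require
      \<open>Second\<close> to be on move and \<open>\<tau>\<close> would require
      \<open>First\<close>.\<close>
    have "\<not> finished n m h"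
      using h \<sigma> \<tau> unfolding winning_strategy_def by (metis opponent.simps player.distinct(1))
    then have ex: "\<exists>s. legal n m h s" using h by (auto simp: finished_def)
    define s where "s = (if mover h = First then \<sigma> h else \<tau> h)"
    have "legal n m h s"
    proof (cases "mover h")
      case First
      then show ?thesis using h ex \<sigma> by (simp add: s_def winning_strategy_def)
    next
      case Second
      then show ?thesis using h ex \<tau> by (simp add: s_def winning_strategy_def)
    qed
    then have "play n m (h @ [s])" using h by (auto intro: play.move)
    moreover have "follows First \<sigma> (h @ [s])" "follows Second \<tau> (h @ [s])"
      using h by (auto simp: s_def)
    ultimately show ?case using h(1) by (intro exI[of _ "h @ [s]"]) simp
  qed
  \<comment> \<open>One move more than the board has squares.\<close>
  then obtain h where "length h = Suc (n * m)" "play n m h" by blast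
  then show False using play_length_le by fastforce
qed

theorem theorem5p4:
  fixes n m :: nat
  assumes "n > 0" and "m > 0"
  shows "wins Second n m \<longleftrightarrow> even n \<and> even m"
proof
  assume "wins Second n m"
  then have "\<not> wins First n m" using not_both_win by blast
  then show "even n \<and> even m" using mirror_strategy_wins[OF assms, of First] by blast
next
  assume "even n \<and> even m"
  then show "wins Second n m" using mirror_strategy_wins[OF assms, of Second] by simp
qed

end
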